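(* Let $\{\langle X_t,G_t\rangle\}_{t\ge 0}$, $G_t=(\mathbb{N},E,C_t)$, be a proper, monotone decreasing, possibly adaptive random walk in changing environment on $\mathbb{N}$, where $E=\{\{j,j+1\}:j\ge 0\}$. Suppose that it is bounded from below by some transient weighted graph $G_\infty=(\mathbb{N},E,C_\infty)$ with positive conductances (that is, $C_t(e)\ge C_\infty(e)$ for all $e\in E$ and all $t$, almost surely). Then the walk is transient, i.e. almost surely $X_t$ visits every vertex of $\mathbb{N}$ only finitely many times.
   Context: A random walk in changing environment (RWCE) on a graph $G=(V,E)$ is a stochastic process $\{\langle X_t,G_t\rangle\}_{t=0}^\infty$ where $X_t\in V$ and $G_t=(V,E,C_t)$ is the graph $G$ equipped with a (random) conductance function $C_t:E\to[0,\infty)$, with total conductance at each vertex finite, such that for all $t$ and $v$, $$\mathbb{P}(X_{t+1}=v\mid \langle X_0,G_0\rangle,\dots,\langle X_t,G_t\rangle)=\frac{C_t(X_t,v)}{\sum_{e\in E: X_t\in e}C_t(e)}.$$ The conductances $C_t$ may depend on the whole history of the process and on extra randomness; "possibly adaptive" means no restriction is placed on this dependence. The RWCE is proper if $0<C_t(e)<\infty$ for all $t$ and $e$. It is monotone decreasing if $C_{t+1}\le C_t$ (edgewise) almost surely for all $t$. Here $\mathbb{N}=\{0,1,2,\dots\}$. A fixed (deterministic) weighted graph is called transient if the usual weighted (reversible) random walk on it is transient; for $\mathbb{N}$ with positive conductances $C_\infty$ this means $\sum_{j\ge0}1/C_\infty(j,j+1)<\infty$. *)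

theory Defs
  imports "HOL-Probability.Probability"
begin

text \<open>
  Graphs have the whole type \<open>'v\<close> as vertex set; an edge set is a set of sets \<open>{u, v}\<close>, and
  conductances are functions on sets of vertices of which only the values on edges matter.
\<close>

definition conductance_between :: "'v set set \<Rightarrow> ('v set \<Rightarrow> real) \<Rightarrow> 'v \<Rightarrow> 'v \<Rightarrow> real" where
  "conductance_between E c u v = (if {u, v} \<in> E then c {u, v} else 0)"

definition total_conductance :: "'v set set \<Rightarrow> ('v set \<Rightarrow> real) \<Rightarrow> 'v \<Rightarrow> real" where
  "total_conductance E c v = (\<Sum>\<^sub>\<infinity>e\<in>{e \<in> E. v \<in> e}. c e)"

definition weighted_graph :: "'v set set \<Rightarrow> ('v set \<Rightarrow> real) \<Rightarrow> bool" where
  "weighted_graph E c \<longleftrightarrow> (\<forall>e\<in>E. 0 \<le> c e) \<and> (\<forall>v. c summable_on {e \<in> E. v \<in> e})"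

text \<open>
  The \<open>\<sigma>\<close>-algebra generated by \<open>\<langle>X\<^sub>0, G\<^sub>0\<rangle>, \<dots>, \<langle>X\<^sub>t, G\<^sub>t\<rangle>\<close>, that is, by the positions and by the
  conductances of all edges up to time \<open>t\<close>.
\<close>

definition history ::
  "'w measure \<Rightarrow> 'v set set \<Rightarrow> (nat \<Rightarrow> 'w \<Rightarrow> 'v) \<Rightarrow> (nat \<Rightarrow> 'w \<Rightarrow> 'v set \<Rightarrow> real) \<Rightarrow> nat \<Rightarrow> 'w measure" where
  "history M E X C t = sigma (space M)
     ({X s -` A \<inter> space M | s A. s \<le> t} \<union>
      {(\<lambda>\<omega>. C s \<omega> e) -` B \<inter> space M | s e B. s \<le> t \<and> e \<in> E \<and> B \<in> sets borel})"

text \<open>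
  The conductances are arbitrary random variables on the underlying probability space, so they may
  depend on the past of the walk and on further randomness. Since division by zero yields zero,
  \<open>transition\<close> forces the total conductance at the current position to be almost surely nonzero
  when there are countably many vertices.
\<close>

locale rwce = prob_space M
  for M :: "'w measure"
    and E :: "'v set set"
    and X :: "nat \<Rightarrow> 'w \<Rightarrow> 'v"
    and C :: "nat \<Rightarrow> 'w \<Rightarrow> 'v set \<Rightarrow> real" +
  assumes position_measurable: "\<And>t. X t \<in> measurable M (count_space UNIV)"
    and conductance_measurable: "\<And>t e. e \<in> E \<Longrightarrow> (\<lambda>\<omega>. C t \<omega> e) \<in> borel_measurable M"
    and weighted: "\<And>t \<omega>. \<omega> \<in> space M \<Longrightarrow> weighted_graph E (C t \<omega>)"
    and transition: "\<And>t v. AE \<omega> in M.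
          real_cond_exp M (history M E X C t) (indicator {\<omega> \<in> space M. X (Suc t) \<omega> = v}) \<omega>
            = conductance_between E (C t \<omega>) (X t \<omega>) v / total_conductance E (C t \<omega>) (X t \<omega>)"

definition proper ::
  "'w measure \<Rightarrow> 'v set set \<Rightarrow> (nat \<Rightarrow> 'w \<Rightarrow> 'v set \<Rightarrow> real) \<Rightarrow> bool" where
  "proper M E C \<longleftrightarrow> (AE \<omega> in M. \<forall>t. \<forall>e\<in>E. 0 < C t \<omega> e)"

definition monotone_decreasing ::
  "'w measure \<Rightarrow> 'v set set \<Rightarrow> (nat \<Rightarrow> 'w \<Rightarrow> 'v set \<Rightarrow> real) \<Rightarrow> bool" where
  "monotone_decreasing M E C \<longleftrightarrow> (\<forall>t. AE \<omega> in M. \<forall>e\<in>E. C (Suc t) \<omega> e \<le> C t \<omega> e)"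

definition bounded_from_below ::
  "'w measure \<Rightarrow> 'v set set \<Rightarrow> (nat \<Rightarrow> 'w \<Rightarrow> 'v set \<Rightarrow> real) \<Rightarrow> ('v set \<Rightarrow> real) \<Rightarrow> bool" where
  "bounded_from_below M E C c \<longleftrightarrow> (AE \<omega> in M. \<forall>t. \<forall>e\<in>E. c e \<le> C t \<omega> e)"

definition transient_walk :: "'w measure \<Rightarrow> (nat \<Rightarrow> 'w \<Rightarrow> 'v) \<Rightarrow> bool" where
  "transient_walk M X \<longleftrightarrow> (AE \<omega> in M. \<forall>v. finite {t. X t \<omega> = v})"

text \<open>
  The weighted random walk on a fixed weighted graph is the walk whose environment is constantly
  \<open>c\<close>. It is realised here on the path space, where \<open>P\<close> ranges over its laws for all initial
  distributions.
\<close>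

definition transient_graph :: "'v set set \<Rightarrow> ('v set \<Rightarrow> real) \<Rightarrow> bool" where
  "transient_graph E c \<longleftrightarrow> weighted_graph E c \<and>
     (\<forall>P :: (nat \<Rightarrow> 'v) measure.
        sets P = sets (Pi\<^sub>M UNIV (\<lambda>_. count_space UNIV)) \<longrightarrow>
        rwce P E (\<lambda>t \<omega>. \<omega> t) (\<lambda>_ _. c) \<longrightarrow>
        transient_walk P (\<lambda>t \<omega>. \<omega> t))"

definition nat_edges :: "nat set set" where
  "nat_edges = {{j, Suc j} | j. True}"

end

theory Submission
  imports Defs
begin

text \<open>
  Let \<open>W\<^sub>t = (\<Sum>j<X\<^sub>t. 1 / C\<^sub>t(j, j+1))\<close> be the effective resistance between \<open>0\<close> and the walker. It
  has no drift under a step of the walk in a fixed environment (and goes up at \<open>0\<close>), and lowering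
  conductances only increases it, so \<open>W\<close> is a submartingale with values in \<open>[0, R]\<close>, where
  \<open>R = (\<Sum>j. 1 / C\<^sub>\<infinity>(j, j+1))\<close>. Hence the sum over \<open>t\<close> of the expectations of
  \<open>(W\<^bsub>t+1\<^esub> - W\<^sub>t)\<^sup>2\<close> is at most \<open>R\<^sup>2\<close>. Each step up from \<open>w\<close> raises \<open>W\<close> by at least
  \<open>1 / C\<^sub>0(w, w+1)\<close>, so almost surely there are finitely many of them; since every visit to \<open>v + 1\<close>
  is followed by a step up or by a visit to \<open>v\<close>, all vertices are visited finitely often.

  That \<open>R\<close> is finite follows from the transience of the weighted graph: if \<open>R\<close> is infinite, then the
  resistance from \<open>0\<close>, set to zero after the return to \<open>0\<close>, is a nonnegative supermartingale that
  tends to infinity if a transient chain never returns; by Fatou's lemma this has probability zero, so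
  the chain started at \<open>0\<close> almost surely never leaves \<open>0\<close> for good. The chain is realised on
  the path space by the Ionescu-Tulcea theorem.
\<close>

section \<open>One step of the walk\<close>

context rwce begin

lemma space_history [simp]: "space (history M E X C t) = space M"
  unfolding history_def by (rule space_measure_of) auto

lemma sets_history:
  "sets (history M E X C t) = sigma_sets (space M)
     ({X s -` A \<inter> space M | s A. s \<le> t} \<union>
      {(\<lambda>\<omega>. C s \<omega> e) -` B \<inter> space M | s e B. s \<le> t \<and> e \<in> E \<and> B \<in> sets borel})"
  unfolding history_def by (rule sets_measure_of) auto

lemma subalgebra_history: "subalgebra M (history M E X C t)"
  unfolding subalgebra_def sets_history
  using measurable_sets[OF position_measurable] measurable_sets[OF conductance_measurable]
  by (intro conjI space_history sets.sigma_sets_subset) auto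

sublocale history: sigma_finite_subalgebra M "history M E X C t" for t
  by (intro finite_measure_subalgebra_is_sigma_finite finite_measure_subalgebra.intro
        finite_measure_subalgebra_axioms.intro subalgebra_history finite_measure_axioms)

lemma position_measurable_history:
  assumes "s \<le> t"
  shows "X s \<in> measurable (history M E X C t) (count_space UNIV)"
proof (rule measurableI)
  fix A
  show "X s -` A \<inter> space (history M E X C t) \<in> sets (history M E X C t)"
    unfolding sets_history space_history using assms by (intro sigma_sets.Basic UnI1) blast
qed simp

lemma conductance_measurable_history:
  assumes "s \<le> t" "e \<in> E"
  shows "(\<lambda>\<omega>. C s \<omega> e) \<in> borel_measurable (history M E X C t)"
proof (rule measurableI)
  fix B :: "real set" assume "B \<in> sets borel"
  then show "(\<lambda>\<omega>. C s \<omega> e) -` B \<inter> space (history M E X C t) \<in> sets (history M E X C t)"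
    unfolding sets_history space_history using assms by (intro sigma_sets.Basic UnI2) blast
qed simp

text \<open>The transition law in integrated form: a history-measurable factor can be pulled through
  the conditional expectation. The vertex \<open>v\<close> is fixed so that the quotient is taken at
  \<open>v\<close> and not at a random position. Its measurability is a hypothesis because on a
  general graph the total conductance may be an infinite sum.\<close>

lemma integral_transition:
  assumes g: "g \<in> borel_measurable (history M E X C t)"
    and int: "integrable M g"
    and Q: "(\<lambda>\<omega>. conductance_between E (C t \<omega>) v u / total_conductance E (C t \<omega>) v)
              \<in> borel_measurable M"
  shows "(\<integral>\<omega>. g \<omega> * of_bool (X t \<omega> = v \<and> X (Suc t) \<omega> = u) \<partial>M)
    = (\<integral>\<omega>. g \<omega> * of_bool (X t \<omega> = v)
        * (conductance_between E (C t \<omega>) v u / total_conductance E (C t \<omega>) v) \<partial>M)"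
proof -
  let ?F = "history M E X C t"
  note [measurable] = g position_measurable_history[OF order.refl, of t] position_measurable Q
  let ?g = "\<lambda>\<omega>. g \<omega> * of_bool (X t \<omega> = v)"
  let ?i = "indicator {\<omega> \<in> space M. X (Suc t) \<omega> = u} :: _ \<Rightarrow> real"
  have gM [measurable]: "g \<in> borel_measurable M"
    by (rule measurable_from_subalg[OF subalgebra_history g])
  have 1: "?g \<in> borel_measurable ?F" by measurable
  have 2: "integrable M (\<lambda>\<omega>. ?g \<omega> * ?i \<omega>)"
    by (rule Bochner_Integration.integrable_bound[OF int]) (auto split: split_indicator)
  have "(\<integral>\<omega>. g \<omega> * of_bool (X t \<omega> = v \<and> X (Suc t) \<omega> = u) \<partial>M) = (\<integral>\<omega>. ?g \<omega> * ?i \<omega> \<partial>M)"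
    by (rule Bochner_Integration.integral_cong) (auto split: split_indicator)
  also have "\<dots> = (\<integral>\<omega>. ?g \<omega> * real_cond_exp M ?F ?i \<omega> \<partial>M)"
    by (rule history.real_cond_exp_intg(2)[symmetric]) (use 1 2 in auto)
  \<comment> \<open>The factor \<open>of_bool (X t \<omega> = v)\<close> in \<open>?g\<close>
    vanishes off the event on which \<open>X t \<omega>\<close> is \<open>v\<close>, so
    \<open>transition\<close> may be used with \<open>v\<close> as the current position.\<close>
  also have "\<dots> = (\<integral>\<omega>. ?g \<omega>
        * (conductance_between E (C t \<omega>) v u / total_conductance E (C t \<omega>) v) \<partial>M)"
  proof (rule integral_cong_AE)
    show "(\<lambda>\<omega>. ?g \<omega> * (conductance_between E (C t \<omega>) v u / total_conductance E (C t \<omega>) v))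
        \<in> borel_measurable M"
      by (intro borel_measurable_times Q) measurable
  qed (use transition[of t u] in auto)
  finally show ?thesis .
qed

end

section \<open>Conductances on the half-line\<close>

abbreviation edge :: "nat \<Rightarrow> nat set" where
  "edge j \<equiv> {j, Suc j}"

lemma edge_in_nat_edges [simp]: "edge j \<in> nat_edges"
  by (auto simp: nat_edges_def)

lemma pair_in_nat_edges_iff: "{u, v} \<in> nat_edges \<longleftrightarrow> v = Suc u \<or> u = Suc v"
  by (auto simp: nat_edges_def doubleton_eq_iff)

lemma edge_eq_iff: "edge i = edge j \<longleftrightarrow> i = j"
  by (auto simp: doubleton_eq_iff)

lemma total_conductance_0: "total_conductance nat_edges c 0 = c (edge 0)"
proof -
  have "{e \<in> nat_edges. 0 \<in> e} = {edge 0}" by (auto simp: nat_edges_def)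
  then show ?thesis by (simp add: total_conductance_def)
qed

lemma total_conductance_Suc:
  "total_conductance nat_edges c (Suc k) = c (edge k) + c (edge (Suc k))"
proof -
  have "{e \<in> nat_edges. Suc k \<in> e} = {edge k, edge (Suc k)}" by (auto simp: nat_edges_def)
  then show ?thesis by (simp add: total_conductance_def edge_eq_iff)
qed

lemma conductance_between_nat:
  "conductance_between nat_edges c u v =
    (if v = Suc u then c (edge u) else if u = Suc v then c (edge v) else 0)"
  by (auto simp: conductance_between_def pair_in_nat_edges_iff insert_commute)

text \<open>The truncations to \<open>to_nat (Y \<omega>) < n\<close> have integrals that are finite
  sums of the given nonnegative ones, and they converge by dominated convergence. This serves when
  \<open>Z\<close> takes both signs and only its average for each value of \<open>Y\<close> is
  controlled.\<close>

lemma (in finite_measure) integral_nonneg_countable_cases: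
  fixes Y :: "'a \<Rightarrow> 'b::countable" and Z :: "'a \<Rightarrow> real"
  assumes int: "integrable M Z" and Y: "Y \<in> measurable M (count_space UNIV)"
    and nn: "\<And>y. 0 \<le> (\<integral>\<omega>. Z \<omega> * of_bool (Y \<omega> = y) \<partial>M)"
  shows "0 \<le> (\<integral>\<omega>. Z \<omega> \<partial>M)"
proof -
  note [measurable] = Y borel_measurable_integrable[OF int]
  let ?Y = "\<lambda>\<omega>. to_nat (Y \<omega>)"
  have int1: "integrable M (\<lambda>\<omega>. Z \<omega> * of_bool (?Y \<omega> = i))" for i
    by (rule Bochner_Integration.integrable_bound[OF int]) auto
  have nn1: "0 \<le> (\<integral>\<omega>. Z \<omega> * of_bool (?Y \<omega> = i) \<partial>M)" for i
  proof (cases "i \<in> range (to_nat :: 'b \<Rightarrow> nat)")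
    case True
    then show ?thesis using nn by (auto simp: inj_eq[OF inj_to_nat])
  next
    \<comment> \<open>A code outside the range of \<open>to_nat\<close> gives an empty
      event.\<close>
    case False
    then have "?Y \<omega> \<noteq> i" for \<omega> by auto
    then show ?thesis by simp
  qed
  have eq: "Z \<omega> * of_bool (?Y \<omega> < n) = (\<Sum>i<n. Z \<omega> * of_bool (?Y \<omega> = i))" for n \<omega>
    by (induction n) (auto simp: less_Suc_eq)
  have "0 \<le> (\<integral>\<omega>. Z \<omega> * of_bool (?Y \<omega> < n) \<partial>M)" for n
    unfolding eq by (subst Bochner_Integration.integral_sum) (intro int1 sum_nonneg nn1)+
  moreover have "(\<lambda>n. \<integral>\<omega>. Z \<omega> * of_bool (?Y \<omega> < n) \<partial>M) \<longlonglongrightarrow> (\<integral>\<omega>. Z \<omega> \<partial>M)"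
  proof (rule integral_dominated_convergence[where w="\<lambda>\<omega>. norm (Z \<omega>)"])
    show "AE \<omega> in M. (\<lambda>n. Z \<omega> * of_bool (?Y \<omega> < n)) \<longlonglongrightarrow> Z \<omega>"
    proof (rule AE_I2)
      fix \<omega>
      have "eventually (\<lambda>n. Z \<omega> * of_bool (?Y \<omega> < n) = Z \<omega>) sequentially"
        using eventually_gt_at_top[of "?Y \<omega>"] by eventually_elim auto
      then show "(\<lambda>n. Z \<omega> * of_bool (?Y \<omega> < n)) \<longlonglongrightarrow> Z \<omega>"
        by (rule tendsto_eventually)
    qed
  qed (use int in auto)
  ultimately show ?thesis by (intro LIMSEQ_le_const) auto
qed

lemma (in finite_measure) integral_zero_countable_cases:
  fixes Y :: "'a \<Rightarrow> 'b::countable" and Z :: "'a \<Rightarrow> real"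
  assumes int: "integrable M Z" and Y: "Y \<in> measurable M (count_space UNIV)"
    and z: "\<And>y. (\<integral>\<omega>. Z \<omega> * of_bool (Y \<omega> = y) \<partial>M) = 0"
  shows "(\<integral>\<omega>. Z \<omega> \<partial>M) = 0"
  using integral_nonneg_countable_cases[OF int Y] z
    integral_nonneg_countable_cases[of "\<lambda>\<omega>. - Z \<omega>", OF _ Y] int
  by force

section \<open>Walks on the half-line: steps to neighbours and detailed balance\<close>

locale nat_rwce = rwce M nat_edges X C
  for M :: "'w measure" and X :: "nat \<Rightarrow> 'w \<Rightarrow> nat" and C :: "nat \<Rightarrow> 'w \<Rightarrow> nat set \<Rightarrow> real" +
  assumes proper: "proper M nat_edges C"
begin

abbreviation \<F> :: "nat \<Rightarrow> 'w measure" where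
  "\<F> t \<equiv> history M nat_edges X C t"

lemma AE_pos: "AE \<omega> in M. \<forall>t j. 0 < C t \<omega> (edge j)"
  using proper unfolding proper_def by eventually_elim auto

text \<open>At a fixed vertex the total conductance has at most two terms, which discharges the
  measurability hypothesis of \<open>integral_transition\<close>.\<close>

lemma transition_probability_measurable:
  "(\<lambda>\<omega>. conductance_between nat_edges (C t \<omega>) v u / total_conductance nat_edges (C t \<omega>) v)
    \<in> borel_measurable M"
proof -
  note [measurable] = conductance_measurable[OF edge_in_nat_edges]
  show ?thesis
    by (cases v) (auto simp: conductance_between_nat total_conductance_0 total_conductance_Suc)
qed

lemmas integral_step = integral_transition[OF _ _ transition_probability_measurable]

text \<open>Moves between non-neighbours have transition probability zero, and only countably many
  null events, one for each time and pair of vertices, have to be united.\<close>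

lemma AE_step: "AE \<omega> in M. \<forall>t. X (Suc t) \<omega> = Suc (X t \<omega>) \<or> X t \<omega> = Suc (X (Suc t) \<omega>)"
proof -
  note [measurable] = position_measurable
  have "AE \<omega> in M. \<not> (X t \<omega> = v \<and> X (Suc t) \<omega> = u)" if "\<not> (u = Suc v \<or> v = Suc u)" for t u v
  proof -
    have "(\<integral>\<omega>. 1 * of_bool (X t \<omega> = v \<and> X (Suc t) \<omega> = u) \<partial>M) = (0::real)"
      using that by (subst integral_step) (auto simp: conductance_between_nat)
    also have "(\<lambda>\<omega>. 1 * of_bool (X t \<omega> = v \<and> X (Suc t) \<omega> = u) :: real)
        = indicator {\<omega>. X t \<omega> = v \<and> X (Suc t) \<omega> = u}"
      by (auto simp: fun_eq_iff)
    finally have "prob ({\<omega>. X t \<omega> = v \<and> X (Suc t) \<omega> = u} \<inter> space M) = 0"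
      by simp
    then have "prob {\<omega> \<in> space M. X t \<omega> = v \<and> X (Suc t) \<omega> = u} = 0"
      by (simp add: Int_def conj_commute)
    then show ?thesis
      by (subst (asm) prob_eq_0) auto
  qed
  then have "AE \<omega> in M. \<forall>t u v. \<not> (u = Suc v \<or> v = Suc u) \<longrightarrow> \<not> (X t \<omega> = v \<and> X (Suc t) \<omega> = u)"
    unfolding AE_all_countable by simp
  then show ?thesis by eventually_elim blast
qed

text \<open>By detailed balance the resistance from \<open>0\<close> has no drift at interior vertices.\<close>

lemma integral_balance:
  assumes g: "g \<in> borel_measurable (\<F> t)"
    and i1: "integrable M (\<lambda>\<omega>. g \<omega> / C t \<omega> (edge (Suc k)))"
    and i2: "integrable M (\<lambda>\<omega>. g \<omega> / C t \<omega> (edge k))"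
  shows "(\<integral>\<omega>. g \<omega> / C t \<omega> (edge (Suc k)) * of_bool (X t \<omega> = Suc k \<and> X (Suc t) \<omega> = Suc (Suc k)) \<partial>M)
    = (\<integral>\<omega>. g \<omega> / C t \<omega> (edge k) * of_bool (X t \<omega> = Suc k \<and> X (Suc t) \<omega> = k) \<partial>M)"
proof -
  note [measurable] = g conductance_measurable_history[OF order.refl edge_in_nat_edges, of t]
  note gM [measurable] = measurable_from_subalg[OF subalgebra_history g]
  note [measurable] = position_measurable conductance_measurable[OF edge_in_nat_edges]
  \<comment> \<open>The resistance of the crossed edge cancels its conductance in the transition
    probability, so both sides become \<open>g \<omega>\<close> divided by the total conductance at
    \<open>Suc k\<close>.\<close>
  have eq: "AE \<omega> in M.
      g \<omega> / C t \<omega> (edge (Suc k)) * of_bool (X t \<omega> = Suc k)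
        * (C t \<omega> (edge (Suc k)) / (C t \<omega> (edge k) + C t \<omega> (edge (Suc k))))
    = g \<omega> / C t \<omega> (edge k) * of_bool (X t \<omega> = Suc k)
        * (C t \<omega> (edge k) / (C t \<omega> (edge k) + C t \<omega> (edge (Suc k))))"
    using AE_pos
  proof eventually_elim
    case (elim \<omega>)
    then have "C t \<omega> (edge (Suc k)) \<noteq> 0" "C t \<omega> (edge k) \<noteq> 0"
      by (metis less_irrefl)+
    then show ?case by simp
  qed
  have m1: "(\<lambda>\<omega>. g \<omega> / C t \<omega> (edge (Suc k))) \<in> borel_measurable (\<F> t)"
    and m2: "(\<lambda>\<omega>. g \<omega> / C t \<omega> (edge k)) \<in> borel_measurable (\<F> t)"
    by measurable
  show ?thesis
    unfolding integral_step[OF m1 i1] integral_step[OF m2 i2]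
    unfolding conductance_between_nat total_conductance_Suc
    using eq by (auto intro!: integral_cong_AE)
qed

lemma positions_measurable [measurable]: "X t \<in> measurable M (count_space UNIV)"
  by (rule position_measurable)

lemma conductances_measurable [measurable]: "(\<lambda>\<omega>. C t \<omega> (edge j)) \<in> borel_measurable M"
  by (rule conductance_measurable) simp

text \<open>The process \<open>W\<^sub>t\<close>. Position and environment are taken at the same
  time, so one step changes both.\<close>

definition resistance :: "nat \<Rightarrow> 'w \<Rightarrow> real" where
  "resistance t \<omega> = (\<Sum>j<X t \<omega>. 1 / C t \<omega> (edge j))"

lemma resistance_measurable [measurable]: "resistance t \<in> borel_measurable M"
  unfolding resistance_def[abs_def]
  by (rule measurable_compose_countable[where f="\<lambda>i \<omega>. \<Sum>j<i. 1 / C t \<omega> (edge j)"]) measurable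

end

section \<open>Decreasing environments with summable resistances\<close>

text \<open>Transience of the lower bound enters in the analytic form of summable resistances; the
  equivalence with the behaviour of a chain is kept out of this argument.\<close>

locale decreasing_nat_rwce = nat_rwce +
  fixes c :: "nat set \<Rightarrow> real"
  assumes decreasing: "monotone_decreasing M nat_edges C"
    and below: "bounded_from_below M nat_edges C c"
    and c_pos: "0 < c (edge j)"
    and summable_resistance: "summable (\<lambda>j. 1 / c (edge j))"
begin

abbreviation R :: real where "R \<equiv> \<Sum>j. 1 / c (edge j)"

lemma AE_below: "AE \<omega> in M. \<forall>t j. c (edge j) \<le> C t \<omega> (edge j)"
  using below unfolding bounded_from_below_def by eventually_elim auto

lemma AE_decreasing: "AE \<omega> in M. \<forall>t j. C (Suc t) \<omega> (edge j) \<le> C t \<omega> (edge j)"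
proof -
  have "AE \<omega> in M. \<forall>t. \<forall>e\<in>nat_edges. C (Suc t) \<omega> e \<le> C t \<omega> e"
    unfolding AE_all_countable using decreasing by (simp add: monotone_decreasing_def)
  then show ?thesis by eventually_elim auto
qed

lemma AE_decreasing_initial: "AE \<omega> in M. \<forall>t j. C t \<omega> (edge j) \<le> C 0 \<omega> (edge j)"
  using AE_decreasing
proof eventually_elim
  case (elim \<omega>)
  have "C t \<omega> (edge j) \<le> C 0 \<omega> (edge j)" for t j
    using elim by (induction t) (auto intro: order_trans)
  then show ?case by blast
qed

text \<open>Stated for all \<open>n\<close> at once, because the estimates below also need the sums
  up to vertices other than the current position.\<close>

lemma AE_partial_resistance:
  "AE \<omega> in M. \<forall>t n. 0 \<le> (\<Sum>j<n. 1 / C t \<omega> (edge j)) \<and> (\<Sum>j<n. 1 / C t \<omega> (edge j)) \<le> R"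
  using AE_below
proof eventually_elim
  case (elim \<omega>)
  have pos: "0 < C t \<omega> (edge j)" for t j
    using elim c_pos[of j] by (meson less_le_trans)
  have "(\<Sum>j<n. 1 / C t \<omega> (edge j)) \<le> (\<Sum>j<n. 1 / c (edge j))" for t n
    using elim c_pos by (intro sum_mono divide_left_mono mult_pos_pos pos) auto
  also have "(\<Sum>j<n. 1 / c (edge j)) \<le> R" for n
    using c_pos by (intro sum_le_suminf summable_resistance) (auto intro: less_imp_le)
  finally show ?case
    using pos by (auto intro!: sum_nonneg intro: less_imp_le)
qed

lemma AE_inverse_bound: "AE \<omega> in M. \<forall>t j. 0 < 1 / C t \<omega> (edge j) \<and> 1 / C t \<omega> (edge j) \<le> 1 / c (edge j)"
  using AE_below AE_pos
proof eventually_elim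
  case (elim \<omega>)
  then show ?case
    using c_pos by (auto intro!: divide_left_mono mult_pos_pos simp: zero_less_divide_iff)
qed

lemma integrable_resistance_square: "integrable M (\<lambda>\<omega>. (resistance t \<omega>)\<^sup>2)"
proof (rule integrable_const_bound[where B="R\<^sup>2"])
  show "AE \<omega> in M. norm ((resistance t \<omega>)\<^sup>2) \<le> R\<^sup>2"
    using AE_partial_resistance
    by eventually_elim (auto simp: resistance_def intro!: power_mono)
qed measurable

text \<open>The squared increment of the resistance in an upward step from \<open>w\<close>, with
  the environment frozen at time \<open>t\<close>. This part of the quadratic variation
  suffices.\<close>

definition up_jump :: "nat \<Rightarrow> nat \<Rightarrow> 'a \<Rightarrow> real" where
  "up_jump w t \<omega> = of_bool (X t \<omega> = w \<and> X (Suc t) \<omega> = Suc w) / (C t \<omega> (edge w))\<^sup>2"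

lemma up_jump_measurable [measurable]: "up_jump w t \<in> borel_measurable M"
  unfolding up_jump_def[abs_def] by measurable

lemma up_jump_nonneg: "0 \<le> up_jump w t \<omega>"
  by (simp add: up_jump_def)

lemma integrable_up_jump: "integrable M (up_jump w t)"
proof (rule integrable_const_bound[where B="(1 / c (edge w))\<^sup>2"])
  show "AE \<omega> in M. norm (up_jump w t \<omega>) \<le> (1 / c (edge w))\<^sup>2"
    using AE_inverse_bound
  proof eventually_elim
    case (elim \<omega>)
    have "norm (up_jump w t \<omega>) \<le> (1 / C t \<omega> (edge w))\<^sup>2"
      by (auto simp: up_jump_def power_divide)
    also have "\<dots> \<le> (1 / c (edge w))\<^sup>2"
      using elim[rule_format, of t w] by (intro power_mono) linarith+
    finally show ?case .
  qed
qed measurable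

lemma AE_resistance_mono:
  "AE \<omega> in M. \<forall>t n. (\<Sum>j<n. 1 / C t \<omega> (edge j)) \<le> (\<Sum>j<n. 1 / C (Suc t) \<omega> (edge j))"
  using AE_decreasing AE_pos
  by eventually_elim (auto intro!: sum_mono divide_left_mono mult_pos_pos)

lemma resistance_square_increment:
  "(\<integral>\<omega>. (resistance t \<omega>)\<^sup>2 \<partial>M) + (\<integral>\<omega>. up_jump w t \<omega> \<partial>M) \<le> (\<integral>\<omega>. (resistance (Suc t) \<omega>)\<^sup>2 \<partial>M)"
proof -
  define Z where "Z \<omega> = (resistance (Suc t) \<omega>)\<^sup>2 - (resistance t \<omega>)\<^sup>2 - up_jump w t \<omega>" for \<omega>
  have intZ: "integrable M Z"
    unfolding Z_def[abs_def] using integrable_resistance_square integrable_up_jump by simp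
  then have [measurable]: "Z \<in> borel_measurable M" by simp
  have "0 \<le> (\<integral>\<omega>. Z \<omega> \<partial>M)"
  proof (rule integral_nonneg_countable_cases[OF intZ position_measurable[of t]])
    fix v
    have intZv: "integrable M (\<lambda>\<omega>. Z \<omega> * of_bool (X t \<omega> = v))"
      by (rule Bochner_Integration.integrable_bound[OF intZ]) auto
    show "0 \<le> (\<integral>\<omega>. Z \<omega> * of_bool (X t \<omega> = v) \<partial>M)"
    proof (cases v)
      case 0
      \<comment> \<open>At \<open>0\<close> the resistance is zero and the only possible step is
        upward, so the inequality holds pathwise, without averaging.\<close>
      have "AE \<omega> in M. 0 \<le> Z \<omega> * of_bool (X t \<omega> = v)"
        using AE_step AE_resistance_mono AE_pos
      proof eventually_elim
        case (elim \<omega>)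
        show ?case
        proof (cases "X t \<omega> = 0")
          case True
          then have X': "X (Suc t) \<omega> = 1"
            using elim(1)[rule_format, of t] by simp
          have "(1 / C t \<omega> (edge 0))\<^sup>2 \<le> (1 / C (Suc t) \<omega> (edge 0))\<^sup>2"
            using elim(2)[rule_format, where n=1 and t=t] elim(3)
            by (intro power_mono) (auto intro: less_imp_le)
          moreover have "up_jump w t \<omega> \<le> (1 / C t \<omega> (edge 0))\<^sup>2"
            using True by (auto simp: up_jump_def power_divide)
          ultimately show ?thesis
            using True X' by (auto simp: Z_def resistance_def)
        qed (use 0 in auto)
      qed
      then show ?thesis by (rule integral_nonneg_AE)
    next
      case (Suc k)
      \<comment> \<open>The coefficient \<open>2 W\<close> of the cross term on the event that the
        walker is at \<open>v\<close>. It involves only conductances at time \<open>t\<close>, hence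
        is a legitimate factor in \<open>integral_balance\<close>.\<close>
      define g where "g \<omega> = 2 * (\<Sum>j<v. 1 / C t \<omega> (edge j))" for \<omega>
      note [measurable] = conductance_measurable_history[OF order.refl edge_in_nat_edges, of t]
      have gF: "g \<in> borel_measurable (\<F> t)"
        unfolding g_def[abs_def] by measurable
      have gM [measurable]: "g \<in> borel_measurable M"
        unfolding g_def[abs_def] by measurable
      have intg: "integrable M (\<lambda>\<omega>. g \<omega> / C t \<omega> (edge j))" for j
      proof (rule integrable_const_bound[where B="2 * R * (1 / c (edge j))"])
        show "AE \<omega> in M. norm (g \<omega> / C t \<omega> (edge j)) \<le> 2 * R * (1 / c (edge j))"
          using AE_inverse_bound AE_partial_resistance
        proof eventually_elim
          case (elim \<omega>)
          have "norm (g \<omega> / C t \<omega> (edge j)) = g \<omega> * (1 / C t \<omega> (edge j))"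
            using elim(1)[rule_format, of t j] elim(2)[rule_format, of t v]
            by (simp add: g_def abs_mult)
          also have "\<dots> \<le> 2 * R * (1 / c (edge j))"
            using elim(1)[rule_format, of t j] elim(2)[rule_format, of t v]
            by (intro mult_mono) (auto simp: g_def)
          finally show ?case .
        qed
      qed measurable
      \<comment> \<open>Absolute values of the cross terms for the upward and the downward step;
        their expectations agree by balance.\<close>
      let ?U = "\<lambda>\<omega>. g \<omega> / C t \<omega> (edge (Suc k)) * of_bool (X t \<omega> = Suc k \<and> X (Suc t) \<omega> = Suc (Suc k))"
      let ?D = "\<lambda>\<omega>. g \<omega> / C t \<omega> (edge k) * of_bool (X t \<omega> = Suc k \<and> X (Suc t) \<omega> = k)"
      have intU: "integrable M ?U"
        by (rule Bochner_Integration.integrable_bound[OF intg[of "Suc k"]]) auto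
      have intD: "integrable M ?D"
        by (rule Bochner_Integration.integrable_bound[OF intg[of k]]) auto
      have "0 = (\<integral>\<omega>. ?U \<omega> \<partial>M) - (\<integral>\<omega>. ?D \<omega> \<partial>M)"
        using integral_balance[OF gF intg intg] by simp
      also have "\<dots> = (\<integral>\<omega>. ?U \<omega> - ?D \<omega> \<partial>M)"
        using intU intD by simp
      also have "\<dots> \<le> (\<integral>\<omega>. Z \<omega> * of_bool (X t \<omega> = v) \<partial>M)"
      proof (rule integral_mono_AE)
        show "AE \<omega> in M. ?U \<omega> - ?D \<omega> \<le> Z \<omega> * of_bool (X t \<omega> = v)"
          using AE_step AE_resistance_mono AE_partial_resistance
        proof eventually_elim
          case (elim \<omega>)
          let ?S = "\<lambda>n. \<Sum>j<n. 1 / C t \<omega> (edge j)"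
          let ?S' = "\<lambda>n. \<Sum>j<n. 1 / C (Suc t) \<omega> (edge j)"
          \<comment> \<open>The change of environment enters here, at the new position
            \<open>n\<close>.\<close>
          have sq: "(?S n)\<^sup>2 \<le> (?S' n)\<^sup>2" for n
            using elim(2,3) by (intro power_mono) auto
          show ?case
          proof (cases "X t \<omega> = v")
            case True
            consider "X (Suc t) \<omega> = Suc v" | "X (Suc t) \<omega> = k"
              using elim(1)[rule_format, of t] True Suc by auto
            then show ?thesis
            proof cases
              case 1
              \<comment> \<open>Equality if \<open>w = v\<close>; otherwise the left side is
                zero.\<close>
              have "up_jump w t \<omega> \<le> (1 / C t \<omega> (edge v))\<^sup>2"
                using True by (auto simp: up_jump_def power_divide)
              moreover have "(?S v)\<^sup>2 + 2 * ?S v * (1 / C t \<omega> (edge v)) + (1 / C t \<omega> (edge v))\<^sup>2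
                  = (?S (Suc v))\<^sup>2"
                by (simp only: sum.lessThan_Suc power2_sum)
              moreover have "?U \<omega> - ?D \<omega> = 2 * ?S v * (1 / C t \<omega> (edge v))"
                using True 1 Suc by (simp add: g_def)
              moreover have "Z \<omega> * of_bool (X t \<omega> = v) = (?S' (Suc v))\<^sup>2 - (?S v)\<^sup>2 - up_jump w t \<omega>"
                using True 1 by (simp add: Z_def resistance_def)
              ultimately show ?thesis
                using sq[of "Suc v"] by linarith
            next
              case 2
              have "up_jump w t \<omega> = 0"
                using True 2 Suc by (auto simp: up_jump_def)
              \<comment> \<open>For a downward step the squared increment is simply dropped.\<close>
              moreover have "(?S v)\<^sup>2 - 2 * ?S v * (1 / C t \<omega> (edge k)) \<le> (?S k)\<^sup>2"
                by (simp add: Suc power2_eq_square algebra_simps)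
              ultimately show ?thesis
                using sq[of k] True 2 Suc
                by (simp add: Z_def resistance_def g_def)
            qed
          qed (use Suc in auto)
        qed
      qed (use intU intD intZv in auto)
      finally show ?thesis .
    qed
  qed
  then show ?thesis
    using integrable_resistance_square integrable_up_jump by (simp add: Z_def)
qed

text \<open>The increments telescope, and the final squared resistance is at most the square of
  \<open>R\<close>.\<close>

lemma sum_up_jumps_le: "(\<Sum>t<n. \<integral>\<omega>. up_jump w t \<omega> \<partial>M) \<le> R\<^sup>2"
proof -
  have "(\<Sum>t<n. \<integral>\<omega>. up_jump w t \<omega> \<partial>M) \<le> (\<integral>\<omega>. (resistance n \<omega>)\<^sup>2 \<partial>M)"
    by (induction n) (auto intro: order_trans[OF _ resistance_square_increment[of _ w]])
  also have "\<dots> \<le> (\<integral>\<omega>. R\<^sup>2 \<partial>M)"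
    using AE_partial_resistance
    by (intro integral_mono_AE integrable_resistance_square)
      (auto simp: resistance_def intro!: power_mono elim!: eventually_mono)
  finally show ?thesis by (simp add: prob_space)
qed

text \<open>The total of \<open>up_jump\<close> has finite expectation, so it is almost surely a
  convergent series; its terms at upward steps stay away from zero.\<close>

lemma AE_finite_up_steps: "AE \<omega> in M. finite {t. X t \<omega> = w \<and> X (Suc t) \<omega> = Suc w}"
proof -
  have "(\<integral>\<^sup>+\<omega>. (\<Sum>t. ennreal (up_jump w t \<omega>)) \<partial>M) = (\<Sum>t. \<integral>\<^sup>+\<omega>. ennreal (up_jump w t \<omega>) \<partial>M)"
    by (rule nn_integral_suminf) measurable
  also have "\<dots> = (\<Sum>t. ennreal (\<integral>\<omega>. up_jump w t \<omega> \<partial>M))"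
    by (intro suminf_cong nn_integral_eq_integral integrable_up_jump) (auto simp: up_jump_nonneg)
  also have "\<dots> \<le> ennreal (R\<^sup>2)"
    using sum_up_jumps_le
    by (intro suminf_le_const)
      (auto simp: sum_ennreal up_jump_nonneg integral_nonneg_AE intro!: ennreal_leI)
  also have "\<dots> < \<infinity>" by simp
  finally have "AE \<omega> in M. (\<Sum>t. ennreal (up_jump w t \<omega>)) \<noteq> \<infinity>"
    by (intro nn_integral_PInf_AE) auto
  then show ?thesis
    using AE_pos AE_decreasing_initial
  proof eventually_elim
    case (elim \<omega>)
    have "summable (\<lambda>t. up_jump w t \<omega>)"
      using elim(1) by (intro summable_suminf_not_top) (auto simp: up_jump_nonneg)
    then have "(\<lambda>t. up_jump w t \<omega>) \<longlonglongrightarrow> 0"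
      by (rule summable_LIMSEQ_zero)
    \<comment> \<open>Conductances never exceed their initial values, so this threshold, which
      depends on the path but not on \<open>t\<close>, is a lower bound for the contribution of
      every upward step.\<close>
    then have "eventually (\<lambda>t. up_jump w t \<omega> < 1 / (C 0 \<omega> (edge w))\<^sup>2) sequentially"
      using elim(2) by (intro order_tendstoD(2)) (auto simp: less_le)
    then obtain T where T: "\<And>t. t \<ge> T \<Longrightarrow> up_jump w t \<omega> < 1 / (C 0 \<omega> (edge w))\<^sup>2"
      by (auto simp: eventually_sequentially)
    have "{t. X t \<omega> = w \<and> X (Suc t) \<omega> = Suc w} \<subseteq> {..<T}"
    proof
      fix t assume t: "t \<in> {t. X t \<omega> = w \<and> X (Suc t) \<omega> = Suc w}"
      show "t \<in> {..<T}"
      proof (rule ccontr)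
        assume "t \<notin> {..<T}"
        then have "up_jump w t \<omega> < 1 / (C 0 \<omega> (edge w))\<^sup>2" using T by simp
        moreover have "1 / (C 0 \<omega> (edge w))\<^sup>2 \<le> 1 / (C t \<omega> (edge w))\<^sup>2"
          using elim by (intro divide_left_mono power_mono mult_pos_pos zero_less_power)
            (auto intro: less_imp_le)
        ultimately show False using t by (simp add: up_jump_def)
      qed
    qed
    then show ?case by (rule finite_subset) simp
  qed
qed

lemma transient: "transient_walk M X"
proof -
  have "AE \<omega> in M. \<forall>w. finite {t. X t \<omega> = w \<and> X (Suc t) \<omega> = Suc w}"
    by (simp add: AE_all_countable AE_finite_up_steps)
  then show ?thesis
    unfolding transient_walk_def using AE_step
  proof eventually_elim
    case (elim \<omega>)
    show ?case
    proof
      fix v show "finite {t. X t \<omega> = v}"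
      proof (induction v)
        case 0
        have "X (Suc t) \<omega> = Suc 0" if "X t \<omega> = 0" for t
          using elim(2)[rule_format, of t] that by simp
        then have "{t. X t \<omega> = 0} \<subseteq> {t. X t \<omega> = 0 \<and> X (Suc t) \<omega> = Suc 0}"
          by blast
        then show ?case using elim(1) finite_subset by blast
      next
        case (Suc k)
        \<comment> \<open>The preimage under \<open>Suc\<close> collects the times just before a
          visit to \<open>k\<close>.\<close>
        have "{t. X t \<omega> = Suc k} \<subseteq> {t. X t \<omega> = Suc k \<and> X (Suc t) \<omega> = Suc (Suc k)}
            \<union> Suc -` {t. X t \<omega> = k}"
        proof
          fix t assume "t \<in> {t. X t \<omega> = Suc k}"
          then show "t \<in> {t. X t \<omega> = Suc k \<and> X (Suc t) \<omega> = Suc (Suc k)} \<union> Suc -` {t. X t \<omega> = k}"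
            using elim(2)[rule_format, of t] by auto
        qed
        moreover have "finite (Suc -` {t. X t \<omega> = k})"
          by (rule finite_vimageI[OF Suc]) simp
        ultimately show ?case using elim(1) by (meson finite_UnI finite_subset)
      qed
    qed
  qed
qed

end

section \<open>Recurrence for divergent resistances\<close>

text \<open>A fixed weighted graph is the constant environment, so \<open>integral_balance\<close>
  serves here as well.\<close>

locale recurrent_nat_walk = nat_rwce M X "\<lambda>_ _. c"
  for M :: "'w measure" and X :: "nat \<Rightarrow> 'w \<Rightarrow> nat" and c :: "nat set \<Rightarrow> real" +
  assumes start: "AE \<omega> in M. X 0 \<omega> = 0"
    and not_summable_resistance: "\<not> summable (\<lambda>j. 1 / c (edge j))"
begin

lemma c_pos: "0 < c (edge j)"
  using AE_pos by simp

text \<open>The resistance from \<open>0\<close>, which is harmonic for the chain except at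
  \<open>0\<close>.\<close>

definition h :: "nat \<Rightarrow> real" where
  "h n = (\<Sum>j<n. 1 / c (edge j))"

lemma h_nonneg: "0 \<le> h n"
  unfolding h_def using c_pos by (auto intro!: sum_nonneg intro: less_imp_le)

lemma h_mono: "m \<le> n \<Longrightarrow> h m \<le> h n"
  unfolding h_def using c_pos by (intro sum_mono2) (auto intro: less_imp_le)

lemma filterlim_h: "filterlim h at_top sequentially"
  unfolding filterlim_at_top
proof
  fix K :: real
  have "\<exists>n. K < h n"
  proof (rule ccontr)
    assume "\<not> ?thesis"
    then have "summable (\<lambda>j. 1 / c (edge j))"
      using c_pos by (intro summableI_nonneg_bounded[where x=K])
        (auto simp: h_def not_less intro: less_imp_le)
    then show False using not_summable_resistance by simp
  qed
  then obtain n where "K < h n" by blast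
  then show "eventually (\<lambda>m. K \<le> h m) sequentially"
    by (intro eventually_sequentiallyI[of n]) (use h_mono in force)
qed

text \<open>As \<open>h\<close> is unbounded, integrability of \<open>h (X t \<omega>)\<close> rests
  on this bound for the position at a given time.\<close>

lemma AE_position_le: "AE \<omega> in M. \<forall>t. X t \<omega> \<le> t"
  using start AE_step
proof eventually_elim
  case (elim \<omega>)
  show ?case
  proof
    fix t show "X t \<omega> \<le> t"
    proof (induction t)
      case (Suc t)
      then show ?case using elim(2)[rule_format, of t] by auto
    qed (use elim in simp)
  qed
qed

text \<open>Indicator that the walk is at \<open>0\<close> at time \<open>t0\<close> and does not
  return up to time \<open>t\<close>. The product form gives its measurability and its one-step
  recursion.\<close>

definition excursion :: "nat \<Rightarrow> nat \<Rightarrow> 'w \<Rightarrow> real" where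
  "excursion t0 t \<omega> = of_bool (X t0 \<omega> = 0) * (\<Prod>r\<in>{t0<..t}. of_bool (X r \<omega> \<noteq> 0))"

lemma excursion_measurable:
  assumes "t0 \<le> t"
  shows "excursion t0 t \<in> borel_measurable (\<F> t)"
proof -
  have [measurable]: "(\<lambda>\<omega>. of_bool (P (X r \<omega>)) :: real) \<in> borel_measurable (\<F> t)" if "r \<le> t" for r P
    by (rule measurable_compose[OF position_measurable_history[OF that]]) simp
  show ?thesis
    unfolding excursion_def[abs_def] using assms
    by (intro borel_measurable_times borel_measurable_prod) auto
qed

lemma excursion_measurable_M [measurable]:
  assumes "t0 \<le> t"
  shows "excursion t0 t \<in> borel_measurable M"
  by (rule measurable_from_subalg[OF subalgebra_history excursion_measurable[OF assms]])

lemma excursion_range: "0 \<le> excursion t0 t \<omega>" "excursion t0 t \<omega> \<le> 1"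
  unfolding excursion_def by (auto intro!: prod_nonneg prod_le_1)

lemma excursion_Suc:
  assumes "t0 \<le> t"
  shows "excursion t0 (Suc t) \<omega> = excursion t0 t \<omega> * of_bool (X (Suc t) \<omega> \<noteq> 0)"
proof -
  have "{t0<..Suc t} = insert (Suc t) {t0<..t}" using assms by auto
  then show ?thesis by (simp add: excursion_def)
qed

text \<open>This removes the vertex at which \<open>h\<close> fails to be harmonic. Strictness
  matters: at time \<open>t0\<close> itself the indicator asks for position
  \<open>0\<close>.\<close>

lemma excursion_at_0:
  assumes "t0 < t" "X t \<omega> = 0"
  shows "excursion t0 t \<omega> = 0"
  using assms by (auto simp: excursion_def intro!: prod_zero)

lemma h_measurable [measurable]: "(\<lambda>\<omega>. h (X t \<omega>)) \<in> borel_measurable M"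
  by (rule measurable_compose[OF position_measurable]) simp

lemma integrable_excursion_h:
  assumes "t0 \<le> t"
  shows "integrable M (\<lambda>\<omega>. excursion t0 t \<omega> * h (X s \<omega>))"
proof (rule integrable_const_bound[where B="h s"])
  show "AE \<omega> in M. norm (excursion t0 t \<omega> * h (X s \<omega>)) \<le> h s"
    using AE_position_le
  proof eventually_elim
    case (elim \<omega>)
    have "excursion t0 t \<omega> * h (X s \<omega>) \<le> 1 * h s"
      using elim by (intro mult_mono excursion_range h_mono h_nonneg) auto
    then show ?case
      by (simp add: abs_mult excursion_range h_nonneg)
  qed
qed (use assms in measurable)

text \<open>During an excursion the walker is away from \<open>0\<close>, where \<open>h\<close> has
  no drift; stopping the excursion on a return discards only nonnegative values.\<close>

lemma excursion_supermartingale: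
  assumes "t0 < t"
  shows "(\<integral>\<omega>. excursion t0 (Suc t) \<omega> * h (X (Suc t) \<omega>) \<partial>M)
    \<le> (\<integral>\<omega>. excursion t0 t \<omega> * h (X t \<omega>) \<partial>M)"
proof -
  have le: "t0 \<le> t" using assms by simp
  note [measurable] = excursion_measurable_M[OF le] position_measurable
  \<comment> \<open>The indicator is kept at time \<open>t\<close> in both terms: it is then
    determined by the history, and the mean of the difference is exactly zero.\<close>
  define Z where "Z \<omega> = excursion t0 t \<omega> * h (X t \<omega>) - excursion t0 t \<omega> * h (X (Suc t) \<omega>)" for \<omega>
  have intZ: "integrable M Z"
    unfolding Z_def[abs_def] by (intro Bochner_Integration.integrable_diff integrable_excursion_h le)
  then have [measurable]: "Z \<in> borel_measurable M" by simp
  have inte: "integrable M (\<lambda>\<omega>. excursion t0 t \<omega> / c (edge j))" for j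
  proof (rule integrable_const_bound[where B="1 / c (edge j)"])
    show "AE \<omega> in M. norm (excursion t0 t \<omega> / c (edge j)) \<le> 1 / c (edge j)"
      using c_pos[of j] by (auto simp: excursion_range abs_mult intro!: divide_right_mono)
  qed measurable
  have "(\<integral>\<omega>. Z \<omega> \<partial>M) = 0"
  proof (rule integral_zero_countable_cases[OF intZ position_measurable[of t]])
    fix v
    show "(\<integral>\<omega>. Z \<omega> * of_bool (X t \<omega> = v) \<partial>M) = 0"
    proof (cases v)
      case 0
      then have "Z \<omega> * of_bool (X t \<omega> = v) = 0" for \<omega>
        using excursion_at_0[OF assms, of \<omega>] by (cases "X t \<omega> = 0") (auto simp: Z_def)
      then show ?thesis by (simp only: Bochner_Integration.integral_zero)
    next
      case (Suc k)
      let ?U = "\<lambda>\<omega>. excursion t0 t \<omega> / c (edge (Suc k)) * of_bool (X t \<omega> = Suc k \<and> X (Suc t) \<omega> = Suc (Suc k))"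
      let ?D = "\<lambda>\<omega>. excursion t0 t \<omega> / c (edge k) * of_bool (X t \<omega> = Suc k \<and> X (Suc t) \<omega> = k)"
      have intU: "integrable M ?U"
        by (rule Bochner_Integration.integrable_bound[OF inte[of "Suc k"]]) auto
      have intD: "integrable M ?D"
        by (rule Bochner_Integration.integrable_bound[OF inte[of k]]) auto
      have "(\<integral>\<omega>. Z \<omega> * of_bool (X t \<omega> = v) \<partial>M) = (\<integral>\<omega>. ?D \<omega> - ?U \<omega> \<partial>M)"
      proof (rule integral_cong_AE)
        show "AE \<omega> in M. Z \<omega> * of_bool (X t \<omega> = v) = ?D \<omega> - ?U \<omega>"
          using AE_step
        proof eventually_elim
          case (elim \<omega>)
          show ?case
            using elim[rule_format, of t] Suc by (auto simp: Z_def h_def algebra_simps)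
        qed
      qed measurable
      also have "\<dots> = (\<integral>\<omega>. ?D \<omega> \<partial>M) - (\<integral>\<omega>. ?U \<omega> \<partial>M)"
        using intU intD by simp
      also have "\<dots> = 0"
        using integral_balance[OF excursion_measurable[OF le] inte inte] by simp
      finally show ?thesis .
    qed
  qed
  then have "(\<integral>\<omega>. excursion t0 t \<omega> * h (X t \<omega>) \<partial>M) = (\<integral>\<omega>. excursion t0 t \<omega> * h (X (Suc t) \<omega>) \<partial>M)"
    by (simp add: Z_def integrable_excursion_h[OF le])
  also have "\<dots> \<ge> (\<integral>\<omega>. excursion t0 (Suc t) \<omega> * h (X (Suc t) \<omega>) \<partial>M)"
    using le by (intro integral_mono integrable_excursion_h)
      (auto simp: excursion_Suc excursion_range h_nonneg)
  finally show ?thesis .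
qed

text \<open>The count starts one step after \<open>t0\<close>: the first step leads from
  \<open>0\<close> to \<open>1\<close>, which gives the value \<open>h 1\<close>, and from there the
  supermartingale property applies.\<close>

lemma excursion_bound: "(\<integral>\<omega>. excursion t0 (Suc (t0 + n)) \<omega> * h (X (Suc (t0 + n)) \<omega>) \<partial>M) \<le> h 1"
proof (induction n)
  case 0
  have "(\<integral>\<omega>. excursion t0 (Suc t0) \<omega> * h (X (Suc t0) \<omega>) \<partial>M) \<le> (\<integral>\<omega>. h 1 \<partial>M)"
  proof (rule integral_mono_AE)
    show "AE \<omega> in M. excursion t0 (Suc t0) \<omega> * h (X (Suc t0) \<omega>) \<le> h 1"
      using AE_step
    proof eventually_elim
      case (elim \<omega>)
      show ?case
      proof (cases "X t0 \<omega> = 0")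
        case True
        then have "X (Suc t0) \<omega> = 1" using elim[rule_format, of t0] by simp
        then show ?thesis
          using mult_right_mono[OF excursion_range(2) h_nonneg] by simp
      qed (simp add: excursion_def h_nonneg)
    qed
  qed (auto intro: integrable_excursion_h)
  then show ?case by (simp add: prob_space)
next
  case (Suc n)
  then show ?case
    using excursion_supermartingale[of t0 "Suc (t0 + n)"] by simp
qed

text \<open>A transient walk started at \<open>0\<close> has a last visit to \<open>0\<close>. For
  each candidate time \<open>t0\<close> this has probability zero: on such an escape the values of
  \<open>h\<close> along the excursion tend to infinity, against Fatou's lemma and the bound
  \<open>h 1\<close>.\<close>

lemma not_transient: "\<not> transient_walk M X"
proof
  assume "transient_walk M X"
  then have fin: "AE \<omega> in M. \<forall>v. finite {t. X t \<omega> = v}"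
    by (simp add: transient_walk_def)
  have no_escape: "AE \<omega> in M. \<not> (X t0 \<omega> = 0 \<and> (\<forall>r>t0. X r \<omega> \<noteq> 0))" for t0
  proof -
    define Z where "Z n \<omega> = excursion t0 (Suc (t0 + n)) \<omega> * h (X (Suc (t0 + n)) \<omega>)" for n \<omega>
    have intZ: "integrable M (Z n)" for n
      unfolding Z_def[abs_def] by (rule integrable_excursion_h) simp
    then have [measurable]: "Z n \<in> borel_measurable M" for n by simp
    have Znn: "0 \<le> Z n \<omega>" for n \<omega>
      by (simp add: Z_def excursion_range h_nonneg)
    have "(\<integral>\<^sup>+\<omega>. liminf (\<lambda>n. ennreal (Z n \<omega>)) \<partial>M) \<le> liminf (\<lambda>n. \<integral>\<^sup>+\<omega>. ennreal (Z n \<omega>) \<partial>M)"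
      by (rule nn_integral_liminf) measurable
    also have "\<dots> = liminf (\<lambda>n. ennreal (\<integral>\<omega>. Z n \<omega> \<partial>M))"
      using intZ Znn by (simp add: nn_integral_eq_integral)
    also have "\<dots> \<le> limsup (\<lambda>n. ennreal (\<integral>\<omega>. Z n \<omega> \<partial>M))"
      by (rule Liminf_le_Limsup) simp
    also have "\<dots> \<le> ennreal (h 1)"
      using excursion_bound[of t0]
      by (intro Limsup_bounded always_eventually allI ennreal_leI) (simp add: Z_def)
    also have "\<dots> < \<infinity>" by simp
    finally have "AE \<omega> in M. liminf (\<lambda>n. ennreal (Z n \<omega>)) \<noteq> \<infinity>"
      by (intro nn_integral_PInf_AE) auto
    then show ?thesis
      using fin
    proof eventually_elim
      case (elim \<omega>)
      show ?case
      proof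
        assume esc: "X t0 \<omega> = 0 \<and> (\<forall>r>t0. X r \<omega> \<noteq> 0)"
        have Z: "Z n \<omega> = h (X (Suc (t0 + n)) \<omega>)" for n
          using esc by (auto simp: Z_def excursion_def)
        \<comment> \<open>Each initial segment of vertices is finite, so it is visited only finitely
          often in total.\<close>
        have "filterlim (\<lambda>t. X t \<omega>) at_top sequentially"
          unfolding filterlim_at_top
        proof
          fix N
          have "{t. \<not> N \<le> X t \<omega>} = (\<Union>v<N. {t. X t \<omega> = v})" by auto
          then have "finite {t. \<not> N \<le> X t \<omega>}" using elim(2) by simp
          then show "eventually (\<lambda>t. N \<le> X t \<omega>) sequentially"
            unfolding cofinite_eq_sequentially[symmetric] eventually_cofinite .
        qed
        moreover have "filterlim (\<lambda>n. Suc (t0 + n)) sequentially sequentially"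
          by (rule filterlim_subseq) (simp add: strict_mono_def)
        ultimately have "filterlim (\<lambda>n. X (Suc (t0 + n)) \<omega>) at_top sequentially"
          by (rule filterlim_compose)
        then have "filterlim (\<lambda>n. Z n \<omega>) at_top sequentially"
          unfolding Z by (rule filterlim_compose[OF filterlim_h])
        then have "(\<lambda>n. ennreal (Z n \<omega>)) \<longlonglongrightarrow> \<infinity>"
          by (simp add: ennreal_tendsto_top_eq_at_top)
        then have "liminf (\<lambda>n. ennreal (Z n \<omega>)) = \<infinity>"
          by (intro lim_imp_Liminf) auto
        then show False using elim(1) by simp
      qed
    qed
  qed
  have "AE \<omega> in M. \<forall>t0. \<not> (X t0 \<omega> = 0 \<and> (\<forall>r>t0. X r \<omega> \<noteq> 0))"
    unfolding AE_all_countable using no_escape by blast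
  then have "AE \<omega> in M. False"
    using fin start
  proof eventually_elim
    case (elim \<omega>)
    \<comment> \<open>Nonempty by the starting position and finite by transience, so its maximum is
      a time of escape.\<close>
    let ?S = "{t. X t \<omega> = 0}"
    have S: "finite ?S" "?S \<noteq> {}" using elim by blast+
    have "X (Max ?S) \<omega> = 0" using Max_in[OF S] by simp
    moreover have "X r \<omega> \<noteq> 0" if "r > Max ?S" for r
      using Max_ge[OF S(1), of r] that by auto
    ultimately show False using elim(1) by blast
  qed
  then show False by simp
qed

end

section \<open>Markov chains on the path space\<close>

text \<open>The Markov property is exported as a product formula for path probabilities, which
  avoids conditioning on null events.\<close>

lemma markov_path_measure_exists:
  fixes K :: "'v::countable \<Rightarrow> 'v pmf" and x0 :: 'v
  obtains P :: "(nat \<Rightarrow> 'v) measure" where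
    "prob_space P" "sets P = sets (Pi\<^sub>M UNIV (\<lambda>_. count_space UNIV))"
    "AE \<omega> in P. \<omega> 0 = x0"
    "\<And>t x. measure P {\<omega>. \<forall>s\<le>Suc t. \<omega> s = x s} =
      measure P {\<omega>. \<forall>s\<le>t. \<omega> s = x s} * pmf (K (x t)) (x (Suc t))"
proof -
  \<comment> \<open>Ionescu-Tulcea kernels may depend on the whole past; these use the last
    coordinate, and index \<open>0\<close> carries the initial law.\<close>
  define Q where "Q i \<omega> = measure_pmf (case i of 0 \<Rightarrow> return_pmf x0 | Suc j \<Rightarrow> K (\<omega> j))"
    for i :: nat and \<omega> :: "nat \<Rightarrow> 'v"
  let ?M = "\<lambda>_::nat. count_space (UNIV :: 'v set)"
  interpret IT: Ionescu_Tulcea Q ?M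
  proof (rule Ionescu_Tulcea.intro)
    show "Q i \<in> measurable (Pi\<^sub>M {0..<i} ?M) (subprob_algebra (count_space UNIV))" for i
    proof (cases i)
      case 0
      then show ?thesis
        by (auto simp: Q_def[abs_def] intro!: measurable_const measure_pmf_in_subprob_space
            simp: space_subprob_algebra)
    next
      case (Suc j)
      have "(\<lambda>\<omega>. measure_pmf (K (\<omega> j))) \<in>
          measurable (Pi\<^sub>M {0..<i} ?M) (subprob_algebra (count_space UNIV))"
        by (rule measurable_compose[OF measurable_component_singleton[where M="?M"]])
          (auto simp: Suc measure_pmf_in_subprob_space)
      then show ?thesis using Suc by (simp add: Q_def[abs_def])
    qed
    show "prob_space (Q i x)" if "x \<in> space (Pi\<^sub>M {0..<i} ?M)" for i x
      unfolding Q_def by (rule prob_space_measure_pmf)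
  qed
  \<comment> \<open>The only extensional function on the empty index set, hence the starting point
    of the finite-dimensional construction.\<close>
  let ?u = "\<lambda>_::nat. undefined :: 'v"
  have sing: "{restrict x {0..<n}} \<in> sets (Pi\<^sub>M {0..<n} ?M)" for x n
  proof -
    have "{restrict x {0..<n}} = PiE {0..<n} (\<lambda>i. {x i})"
      by (auto simp: PiE_iff extensional_def fun_eq_iff)
    also have "\<dots> \<in> sets (Pi\<^sub>M {0..<n} ?M)" by (rule sets_PiM_I_finite) auto
    finally show ?thesis .
  qed
  have cyl: "emeasure IT.PF.lim {\<omega>. \<forall>s<n. \<omega> s = x s} = emeasure (IT.C 0 n ?u) {restrict x {0..<n}}"
    for n x
  proof -
    have "{\<omega>. \<forall>s<n. \<omega> s = x s} = prod_emb UNIV ?M {0..<n} {restrict x {0..<n}}"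
      by (auto simp: prod_emb_def fun_eq_iff restrict_def space_PiM; metis)
    then have "emeasure IT.PF.lim {\<omega>. \<forall>s<n. \<omega> s = x s} = emeasure (IT.CI {0..<n}) {restrict x {0..<n}}"
      using IT.lim[of "{0..<n}", OF _ sing] by simp
    also have "\<dots> = emeasure (IT.C 0 n ?u) (prod_emb {0..<n} ?M {0..<n} {restrict x {0..<n}})"
      by (rule IT.emeasure_CI) (auto intro: sing)
    also have "prod_emb {0..<n} ?M {0..<n} {restrict x {0..<n}} = {restrict x {0..<n}}"
      by (rule prod_emb_id) auto
    finally show ?thesis .
  qed
  have step: "emeasure (IT.C 0 (Suc n) ?u) {restrict x {0..<Suc n}} =
      emeasure (Q n (restrict x {0..<n})) {x n} * emeasure (IT.C 0 n ?u) {restrict x {0..<n}}" for n x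
  proof -
    have u: "?u \<in> space (Pi\<^sub>M {0..<0} ?M)" by (simp add: space_PiM)
    have sC: "sets (IT.C 0 n ?u) = sets (Pi\<^sub>M {0..<n} ?M)"
      using IT.sets_C[OF u, of n] by simp
    have spC: "space (IT.C 0 n ?u) = space (Pi\<^sub>M {0..<n} ?M)"
      using IT.space_C[OF u, of n] by simp
    have ne: "space (IT.C 0 n ?u) \<noteq> {}"
      unfolding spC space_PiM by (simp add: PiE_eq_empty_iff)
    have "emeasure (IT.C 0 (Suc n) ?u) {restrict x {0..<Suc n}} =
        (\<integral>\<^sup>+\<omega>. emeasure (IT.eP n \<omega>) {restrict x {0..<Suc n}} \<partial>IT.C 0 n ?u)"
      using IT.measurable_eP[of n] sC ne
      by (simp, subst emeasure_bind[where N="Pi\<^sub>M {0..<Suc n} ?M"])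
        (auto intro!: sing simp del: restrict_apply simp: measurable_cong_sets[OF sC refl])
    also have "\<dots> = (\<integral>\<^sup>+\<omega>. emeasure (Q n (restrict x {0..<n})) {x n} * indicator {restrict x {0..<n}} \<omega> \<partial>IT.C 0 n ?u)"
    proof (rule nn_integral_cong)
      fix \<omega> assume "\<omega> \<in> space (IT.C 0 n ?u)"
      then have \<omega>: "\<omega> \<in> space (Pi\<^sub>M {0..<n} ?M)" by (simp add: spC)
      then have ext: "\<omega> \<in> extensional {0..<n}" by (auto simp: space_PiM PiE_def)
      \<comment> \<open>A one-point extension hits the prescribed path exactly if the old part
        agrees with it and the new value is \<open>x n\<close>; this yields the product.\<close>
      have "(\<lambda>z. fun_upd \<omega> n z) -` {restrict x {0..<Suc n}} = (if \<omega> = restrict x {0..<n} then {x n} else {})"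
      proof -
        have "fun_upd \<omega> n z = restrict x {0..<Suc n} \<longleftrightarrow> \<omega> = restrict x {0..<n} \<and> z = x n" for z
        proof
          assume eq: "fun_upd \<omega> n z = restrict x {0..<Suc n}"
          have "\<omega> i = restrict x {0..<n} i" for i
            using fun_cong[OF eq, of i] extensional_arb[OF ext, of i]
            by (cases "i < n"; cases "i = n") auto
          then show "\<omega> = restrict x {0..<n} \<and> z = x n"
            using fun_cong[OF eq, of n] by auto
        qed (auto simp: fun_eq_iff)
        then show ?thesis
          by (cases "\<omega> = restrict x {0..<n}") (simp_all only: vimage_def, simp_all)
      qed
      then show "emeasure (IT.eP n \<omega>) {restrict x {0..<Suc n}} =
          emeasure (Q n (restrict x {0..<n})) {x n} * indicator {restrict x {0..<n}} \<omega>"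
        by (simp add: IT.emeasure_eP[OF \<omega> sing])
    qed
    also have "\<dots> = emeasure (Q n (restrict x {0..<n})) {x n} * emeasure (IT.C 0 n ?u) {restrict x {0..<n}}"
      by (rule nn_integral_cmult_indicator) (simp add: sC sing)
    finally show ?thesis .
  qed
  have sets_lim: "sets IT.PF.lim = sets (Pi\<^sub>M UNIV ?M)" by simp
  have C0: "emeasure (IT.C 0 0 ?u) {restrict x {0..<0}} = 1" for x
    unfolding IT.C.simps by (subst emeasure_return) (use sing[of x 0] in \<open>auto simp: restrict_def\<close>)
  interpret P: prob_space IT.PF.lim
  proof
    \<comment> \<open>The cylinder of length \<open>0\<close> is the whole space.\<close>
    show "emeasure IT.PF.lim (space IT.PF.lim) = 1"
      using cyl[of 0 ?u] unfolding C0 by (simp add: space_PiM)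
  qed
  show ?thesis
  proof
    show "prob_space IT.PF.lim" by (rule P.prob_space_axioms)
    show "sets IT.PF.lim = sets (Pi\<^sub>M UNIV ?M)" by (rule sets_lim)
    have "emeasure IT.PF.lim {\<omega>. \<forall>s<Suc 0. \<omega> s = x0} = 1"
      unfolding cyl[of "Suc 0" "\<lambda>_. x0"] step C0
      by (simp add: Q_def emeasure_pmf_single restrict_def space_PiM)
    then show "AE \<omega> in IT.PF.lim. \<omega> 0 = x0"
      by (intro P.AE_prob_1[THEN eventually_mono]) (auto simp: measure_def)
    fix t x
    have "emeasure IT.PF.lim {\<omega>. \<forall>s<Suc (Suc t). \<omega> s = x s} =
        ennreal (pmf (K (x t)) (x (Suc t))) * emeasure IT.PF.lim {\<omega>. \<forall>s<Suc t. \<omega> s = x s}"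
      unfolding cyl[of "Suc (Suc t)"] cyl[of "Suc t"] step[of "Suc t"]
      by (simp add: Q_def emeasure_pmf_single)
    then show "measure IT.PF.lim {\<omega>. \<forall>s\<le>Suc t. \<omega> s = x s} =
      measure IT.PF.lim {\<omega>. \<forall>s\<le>t. \<omega> s = x s} * pmf (K (x t)) (x (Suc t))"
      by (simp add: measure_def less_Suc_eq_le enn2real_mult mult.commute)
  qed
qed

text \<open>With a deterministic environment the history up to \<open>t\<close> is generated by the
  first \<open>t + 1\<close> coordinates, whose countably many joint values are atoms. It suffices
  to compare integrals on each atom, where the product formula gives equality.\<close>

lemma markov_path_measure_rwce:
  fixes P :: "(nat \<Rightarrow> 'v::countable) measure" and K :: "'v \<Rightarrow> 'v pmf"
  assumes prob: "prob_space P"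
    and sets_P: "sets P = sets (Pi\<^sub>M UNIV (\<lambda>_. count_space UNIV))"
    and chain: "\<And>t x. measure P {\<omega>. \<forall>s\<le>Suc t. \<omega> s = x s} =
      measure P {\<omega>. \<forall>s\<le>t. \<omega> s = x s} * pmf (K (x t)) (x (Suc t))"
    and c: "weighted_graph E c"
    and K: "\<And>u v. pmf (K v) u = conductance_between E c v u / total_conductance E c v"
  shows "rwce P E (\<lambda>t \<omega>. \<omega> t) (\<lambda>_ _. c)"
proof -
  interpret prob_space P by (rule prob)
  have space_P [simp]: "space P = UNIV"
    using sets_eq_imp_space_eq[OF sets_P] by (simp add: space_PiM)
  have coord [measurable]: "(\<lambda>\<omega>. \<omega> t) \<in> measurable P (count_space UNIV)" for t
    using measurable_component_singleton[of t UNIV "\<lambda>_. count_space UNIV"]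
    by (simp add: measurable_cong_sets[OF sets_P refl])
  let ?F = "history P E (\<lambda>t \<omega>. \<omega> t) (\<lambda>_ _. c)"
  let ?G = "\<lambda>t. {(\<lambda>\<omega>. \<omega> s) -` A \<inter> space P | s A. s \<le> t} \<union>
      {(\<lambda>\<omega>. c e) -` B \<inter> space P | s e B. s \<le> t \<and> e \<in> E \<and> B \<in> sets borel}"
  have space_F: "space (?F t) = UNIV" for t
    unfolding history_def by (subst space_measure_of) auto
  have sets_F: "sets (?F t) = sigma_sets UNIV (?G t)" for t
    unfolding history_def by (subst sets_measure_of) auto
  have G: "?G t \<subseteq> sets P" for t
  proof
    fix A assume "A \<in> ?G t"
    then consider s B where "A = (\<lambda>\<omega>. \<omega> s) -` B \<inter> space P" | e B where "A = (\<lambda>\<omega>. c e) -` B \<inter> space P"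
      by blast
    then show "A \<in> sets P"
    proof cases
      case 1
      then show ?thesis using measurable_sets[OF coord, of B s] by simp
    next
      case 2
      then have "A = {} \<or> A = space P" by auto
      then show ?thesis using sets.top[of P] by auto
    qed
  qed
  have sub: "subalgebra P (?F t)" for t
    using sets.sigma_sets_subset[OF G[of t]] by (simp add: subalgebra_def space_F sets_F)
  \<comment> \<open>History events do not separate paths that agree up to time \<open>t\<close>; the
    conductance generators are empty or the whole space.\<close>
  have saturated: "\<omega> \<in> A \<longleftrightarrow> \<omega>' \<in> A"
    if "A \<in> sets (?F t)" "\<And>s. s \<le> t \<Longrightarrow> \<omega> s = \<omega>' s" for A t \<omega> \<omega>'
    using that(1) unfolding sets_F
    by (induction rule: sigma_sets.induct) (use that(2) in \<open>auto split: if_splits\<close>)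
  have cond: "AE \<omega> in P. real_cond_exp P (?F t) (indicator {\<omega> \<in> space P. \<omega> (Suc t) = u}) \<omega>
      = pmf (K (\<omega> t)) u" for t u
  proof -
    interpret F: sigma_finite_subalgebra P "?F t"
      by (intro finite_measure_subalgebra_is_sigma_finite finite_measure_subalgebra.intro
          finite_measure_subalgebra_axioms.intro sub finite_measure_axioms)
    let ?f = "indicator {\<omega> \<in> space P. \<omega> (Suc t) = u} :: _ \<Rightarrow> real"
    let ?g = "\<lambda>\<omega>. pmf (K (\<omega> t)) u"
    have gm [measurable]: "?g \<in> borel_measurable P"
      by (rule measurable_compose[OF coord]) simp
    have int_f: "integrable P ?f"
      by (rule integrable_const_bound[where B=1]) auto
    have int_g: "integrable P ?g"
      by (rule integrable_const_bound[where B=1]) (auto simp: pmf_le_1)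
    show ?thesis
    proof (rule F.real_cond_exp_charact)
      show "?g \<in> borel_measurable (?F t)"
      proof (rule measurable_compose[where N="count_space UNIV" and f="\<lambda>\<omega>. \<omega> t" and g="\<lambda>v. pmf (K v) u"])
        show "(\<lambda>\<omega>. \<omega> t) \<in> measurable (?F t) (count_space UNIV)"
        proof (rule measurableI)
          fix A
          show "(\<lambda>\<omega>. \<omega> t) -` A \<inter> space (?F t) \<in> sets (?F t)"
            unfolding sets_F space_F by (intro sigma_sets.Basic UnI1) auto
        qed simp
      qed simp
      fix A assume A: "A \<in> sets (?F t)"
      then have [measurable]: "A \<in> sets P" using sub by (auto simp: subalgebra_def)
      let ?path = "\<lambda>\<omega>. map \<omega> [0..<Suc t]"
      have path_eq: "?path \<omega> = l \<longleftrightarrow> length l = Suc t \<and> (\<forall>s\<le>t. \<omega> s = l ! s)" for \<omega> l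
        by (auto simp: list_eq_iff_nth_eq less_Suc_eq_le simp del: upt_Suc)
      have path [measurable]: "?path \<in> measurable P (count_space UNIV)"
      proof (subst measurable_count_space_eq2_countable)
        have "?path -` {l} \<inter> space P = (if length l = Suc t then {\<omega> \<in> space P. \<forall>s\<le>t. \<omega> s = l ! s} else {})"
          for l using path_eq[of _ l] by (auto simp del: upt_Suc)
        moreover have "{\<omega> \<in> space P. \<forall>s\<le>t. \<omega> s = l ! s} \<in> sets P" for l
          by measurable
        ultimately show "?path \<in> space P \<rightarrow> UNIV \<and> (\<forall>l\<in>UNIV. ?path -` {l} \<inter> space P \<in> sets P)"
          by (simp del: upt_Suc)
      qed
      have int_Z: "integrable P (\<lambda>\<omega>. indicator A \<omega> * (?f \<omega> - ?g \<omega>))"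
        by (rule Bochner_Integration.integrable_bound[OF Bochner_Integration.integrable_diff[OF int_f int_g]])
          (auto simp: indicator_def)
      have "(\<integral>\<omega>. indicator A \<omega> * (?f \<omega> - ?g \<omega>) \<partial>P) = 0"
      proof (rule integral_zero_countable_cases[OF int_Z path])
        fix l :: "'v list"
        define B where "B = {\<omega>. \<forall>s\<le>t. \<omega> s = l ! s}"
        have "{\<omega> \<in> space P. \<forall>s\<le>t. \<omega> s = l ! s} \<in> sets P" by measurable
        then have B [measurable]: "B \<in> sets P" by (simp add: B_def)
        have "{\<omega> \<in> space P. \<forall>s\<le>t. \<omega> s = l ! s} \<inter> {\<omega> \<in> space P. \<omega> (Suc t) = u} \<in> sets P" by measurable
        then have B' [measurable]: "B \<inter> {\<omega>. \<omega> (Suc t) = u} \<in> sets P" by (simp add: B_def)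
        have chain_B: "measure P (B \<inter> {\<omega>. \<omega> (Suc t) = u}) = measure P B * pmf (K (l ! t)) u"
        proof -
          \<comment> \<open>The path that follows \<open>l\<close> up to time \<open>t\<close> and
            then moves to \<open>u\<close>.\<close>
          define x where "x s = (if s \<le> t then l ! s else u)" for s
          have "B \<inter> {\<omega>. \<omega> (Suc t) = u} = {\<omega>. \<forall>s\<le>Suc t. \<omega> s = x s}" "B = {\<omega>. \<forall>s\<le>t. \<omega> s = x s}"
            by (auto simp: B_def x_def le_Suc_eq)
          then show ?thesis using chain[of t x] by (simp add: x_def)
        qed
        have "(\<integral>\<omega>. (?f \<omega> - ?g \<omega>) * indicator B \<omega> \<partial>P)
            = (\<integral>\<omega>. indicator (B \<inter> {\<omega>. \<omega> (Suc t) = u}) \<omega> - pmf (K (l ! t)) u * indicator B \<omega> \<partial>P)"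
          by (rule Bochner_Integration.integral_cong) (auto simp: B_def split: split_indicator)
        also have "\<dots> = 0"
          using chain_B B B'
          by (subst Bochner_Integration.integral_diff) (auto simp: emeasure_eq_measure)
        finally have zero: "(\<integral>\<omega>. (?f \<omega> - ?g \<omega>) * indicator B \<omega> \<partial>P) = 0" .
        \<comment> \<open>By \<open>saturated\<close> an atom is contained in \<open>A\<close> or
          disjoint from it; a list of the wrong length belongs to no path.\<close>
        show "(\<integral>\<omega>. indicator A \<omega> * (?f \<omega> - ?g \<omega>) * of_bool (?path \<omega> = l) \<partial>P) = 0"
        proof (cases "length l = Suc t \<and> A \<inter> B \<noteq> {}")
          case True
          then obtain \<omega>' where \<omega>': "\<omega>' \<in> A" "\<omega>' \<in> B" by blast
          have "B \<subseteq> A"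
          proof
            fix \<omega> assume "\<omega> \<in> B"
            then show "\<omega> \<in> A"
              using saturated[OF A, of \<omega> \<omega>'] \<omega>' by (simp add: B_def)
          qed
          then have "indicator A \<omega> * (?f \<omega> - ?g \<omega>) * of_bool (?path \<omega> = l) = (?f \<omega> - ?g \<omega>) * indicator B \<omega>" for \<omega>
            using True path_eq[of \<omega> l] by (auto simp: B_def split: split_indicator simp del: upt_Suc)
          then show ?thesis using zero by (simp only:)
        next
          case False
          then have "indicator A \<omega> * (?f \<omega> - ?g \<omega>) * of_bool (?path \<omega> = l) = 0" for \<omega>
            using path_eq[of \<omega> l] by (auto simp: B_def split: split_indicator simp del: upt_Suc)
          then show ?thesis by (simp only: Bochner_Integration.integral_zero)
        qed
      qed
      moreover have "integrable P (\<lambda>\<omega>. indicator A \<omega> * ?f \<omega>)" "integrable P (\<lambda>\<omega>. indicator A \<omega> * ?g \<omega>)"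
        by (rule Bochner_Integration.integrable_bound[OF int_f], auto simp: indicator_def)
          (rule Bochner_Integration.integrable_bound[OF int_g], auto simp: indicator_def)
      ultimately show "(\<integral>\<omega>\<in>A. ?f \<omega> \<partial>P) = (\<integral>\<omega>\<in>A. ?g \<omega> \<partial>P)"
        by (simp add: set_lebesgue_integral_def right_diff_distrib)
    qed (fact int_f int_g)+
  qed
  show ?thesis
    by unfold_locales (use c cond K in auto)
qed

section \<open>Transience\<close>

text \<open>Transience of the graph quantifies over all laws of the chain, so one law that is not
  transient refutes it: the chain started at \<open>0\<close>.\<close>

lemma divergent_resistance_imp_not_transient_graph:
  assumes pos: "\<And>j. 0 < c (edge j)"
    and c: "weighted_graph nat_edges c"
    and div: "\<not> summable (\<lambda>j. 1 / c (edge j))"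
  shows "\<not> transient_graph nat_edges c"
proof
  assume trans: "transient_graph nat_edges c"
  \<comment> \<open>The probability of going up from \<open>Suc k\<close>; from \<open>0\<close> the
    kernel \<open>K\<close> always moves to \<open>1\<close>.\<close>
  define p where "p k = c (edge (Suc k)) / (c (edge k) + c (edge (Suc k)))" for k
  define K where "K v = (case v of 0 \<Rightarrow> return_pmf 1
    | Suc k \<Rightarrow> map_pmf (\<lambda>b. if b then Suc (Suc k) else k) (bernoulli_pmf (p k)))" for v
  have p: "0 \<le> p k" "p k \<le> 1" "1 - p k = c (edge k) / (c (edge k) + c (edge (Suc k)))" for k
    using pos[of k] pos[of "Suc k"] by (auto simp: p_def field_simps)
  have K: "pmf (K v) u = conductance_between nat_edges c v u / total_conductance nat_edges c v" for u v
  proof (cases v)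
    case 0
    then show ?thesis
      using pos[of 0] by (simp add: K_def pmf_return conductance_between_nat total_conductance_0)
  next
    case (Suc k)
    have "pmf (K v) u = measure (bernoulli_pmf (p k)) ((\<lambda>b. if b then Suc (Suc k) else k) -` {u})"
      by (simp add: K_def Suc pmf_map)
    also have "(\<lambda>b. if b then Suc (Suc k) else k) -` {u} =
        (if u = Suc (Suc k) then {True} else if u = k then {False} else {})"
      by (auto split: if_splits)
    finally show ?thesis
      using Suc
      by (auto simp: p measure_pmf_single conductance_between_nat total_conductance_Suc)
        (simp add: p_def)
  qed
  obtain P :: "(nat \<Rightarrow> nat) measure" where P: "prob_space P"
      "sets P = sets (Pi\<^sub>M UNIV (\<lambda>_. count_space UNIV))" "AE \<omega> in P. \<omega> 0 = 0"
      "\<And>t x. measure P {\<omega>. \<forall>s\<le>Suc t. \<omega> s = x s} =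
        measure P {\<omega>. \<forall>s\<le>t. \<omega> s = x s} * pmf (K (x t)) (x (Suc t))"
    by (rule markov_path_measure_exists[of 0 K]) (rule that)
  have rwce: "rwce P nat_edges (\<lambda>t \<omega>. \<omega> t) (\<lambda>_ _. c)"
    by (rule markov_path_measure_rwce[OF P(1,2,4) c K])
  interpret recurrent_nat_walk P "\<lambda>t \<omega>. \<omega> t" c
  proof (intro recurrent_nat_walk.intro nat_rwce.intro rwce)
    show "nat_rwce_axioms P (\<lambda>_ _. c)"
      using pos by (auto simp: nat_rwce_axioms_def proper_def nat_edges_def)
    show "recurrent_nat_walk_axioms P (\<lambda>t \<omega>. \<omega> t) c"
      using P(3) div by (simp add: recurrent_nat_walk_axioms_def)
  qed
  have "transient_walk P (\<lambda>t \<omega>. \<omega> t)"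
    using trans P(2) rwce unfolding transient_graph_def by blast
  then show False using not_transient by simp
qed

theorem theorem4p3:
  fixes M :: "'w measure"
    and X :: "nat \<Rightarrow> 'w \<Rightarrow> nat"
    and C :: "nat \<Rightarrow> 'w \<Rightarrow> nat set \<Rightarrow> real"
    and C_inf :: "nat set \<Rightarrow> real"
  assumes "rwce M nat_edges X C"
    and "proper M nat_edges C"
    and "monotone_decreasing M nat_edges C"
    and "\<forall>e\<in>nat_edges. 0 < C_inf e"
    and "transient_graph nat_edges C_inf"
    and "bounded_from_below M nat_edges C C_inf"
  shows "transient_walk M X"
proof -
  have pos: "0 < C_inf (edge j)" for j
    using assms(4) by simp
  \<comment> \<open>By contraposition, the probabilistic assumption on \<open>C_inf\<close> becomes
    the finite bound for the resistance.\<close>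
  have "summable (\<lambda>j. 1 / C_inf (edge j))"
    using divergent_resistance_imp_not_transient_graph[of C_inf, OF pos] assms(5)
    by (auto simp: transient_graph_def)
  then interpret decreasing_nat_rwce M X C C_inf
    by (intro decreasing_nat_rwce.intro nat_rwce.intro nat_rwce_axioms.intro
        decreasing_nat_rwce_axioms.intro assms pos)
  show ?thesis by (rule transient)
qed

end
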